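(* In the double auction described in the context, no winning buyer pays more than its buy-bid price, and no winning seller is paid less than its sell-bid price: for every VM type $m\in[1,M]$, every cloud $i\in[1,F]$ and every slot $t$, if the buy-bid of cloud $i$ for type-$m$ VMs wins then $\hat b_i^m(t)\le b_i^m(t)$, and if the sell-bid of cloud $i$ for type-$m$ VMs wins then $\hat s_i^m(t)\ge s_i^m(t)$.
   Context: There are $F$ clouds and $M$ types of virtual machines (VMs). The double auction is run separately for each VM type $m$ in each slot $t$. Every cloud $i\in[1,F]=\{1,\dots,F\}$ submits a buy-bid with unit price $b_i^m(t)$ and quantity $\gamma_i^m(t)$, and a sell-bid with unit price $s_i^m(t)$ and quantity $\eta_i^m(t)$. The quantities are fixed to $\gamma_i^m(t)=\sum_{j\in[1,F]}C_j^mN_j^m$ and $\eta_i^m(t)=C_i^mN_i^m$, where $N_i^m$ is the number of servers for type-$m$ VMs at cloud $i$ and $C_i^m$ the maximum number of such VMs per server; the prices are chosen by the clouds. Let $\theta_j^m(t)$ be the $j$-th highest buy price and $\vartheta_j^m(t)$ the $j$-th lowest sell price (ties broken arbitrarily), with $L_j^m(t)$ the quantity of the sell-bid with $j$-th lowest price. Let $j'$ be the critical index: $\vartheta_{j'}^m(t)\le\theta_2^m(t)$ and $\vartheta_{j'+1}^m(t)>\theta_2^m(t)$ (i.e. $\vartheta_{j'}^m(t)$ is the last sell price in the sorted order not exceeding $\theta_2^m(t)$). Winners: if at least two sell prices are no higher than $\theta_2^m(t)$ (i.e. $\vartheta_2^m(t)\le\theta_2^m(t)$), then the highest buy-bid wins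 and the sell-bids ranked $1,\dots,j'-1$ win; otherwise no bid wins. Outcome: if $b_i^m(t)$ wins, the unit price charged to buyer $i$ is $\hat b_i^m(t)=\theta_2^m(t)$ and the number of VMs bought is $\hat\gamma_i^m(t)=\sum_{j=1}^{j'-1}L_j^m(t)$; otherwise both are $0$. If $s_i^m(t)$ wins, the unit price paid to seller $i$ is $\hat s_i^m(t)=\vartheta_{j'}^m(t)$ and the number of VMs sold is $\hat\eta_i^m(t)=\eta_i^m(t)$; otherwise both are $0$. *)

theory Defs
  imports Complex_Main
begin

text \<open>
  One run of the double auction (for one VM type, in one slot), with the clouds numbered
  \<open>1, \<dots>, num_clouds\<close>. The functions \<open>buy_order\<close> and \<open>sell_order\<close> send a rank to the cloud that
  holds this rank; a bidding profile with equal prices admits several such orders, and any of them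
  may be used. Ranks and clouds outside \<open>{1..num_clouds}\<close> are meaningless.
\<close>

record auction =
  num_clouds :: nat
  buy_price :: "nat \<Rightarrow> real"
  buy_qty :: "nat \<Rightarrow> nat"
  sell_price :: "nat \<Rightarrow> real"
  sell_qty :: "nat \<Rightarrow> nat"
  buy_order :: "nat \<Rightarrow> nat"
  sell_order :: "nat \<Rightarrow> nat"

definition descending_order :: "nat \<Rightarrow> (nat \<Rightarrow> real) \<Rightarrow> (nat \<Rightarrow> nat) \<Rightarrow> bool" where
  "descending_order F p r \<longleftrightarrow>
     bij_betw r {1..F} {1..F} \<and> (\<forall>j\<in>{1..F}. \<forall>k\<in>{1..F}. j \<le> k \<longrightarrow> p (r j) \<ge> p (r k))"

definition ascending_order :: "nat \<Rightarrow> (nat \<Rightarrow> real) \<Rightarrow> (nat \<Rightarrow> nat) \<Rightarrow> bool" where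
  "ascending_order F p r \<longleftrightarrow>
     bij_betw r {1..F} {1..F} \<and> (\<forall>j\<in>{1..F}. \<forall>k\<in>{1..F}. j \<le> k \<longrightarrow> p (r j) \<le> p (r k))"

definition ranked_buy_price :: "auction \<Rightarrow> nat \<Rightarrow> real" where
  "ranked_buy_price A j = buy_price A (buy_order A j)"

definition ranked_sell_price :: "auction \<Rightarrow> nat \<Rightarrow> real" where
  "ranked_sell_price A j = sell_price A (sell_order A j)"

definition ranked_sell_qty :: "auction \<Rightarrow> nat \<Rightarrow> nat" where
  "ranked_sell_qty A j = sell_qty A (sell_order A j)"

text \<open>
  The rank of the last sell price not exceeding the second highest buy price. If no sell price
  exceeds it, this is the last rank, so that there is no next sell price to compare with.
  Only meaningful if \<open>trade\<close> (below) holds; otherwise the set may be empty.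
\<close>

definition critical_index :: "auction \<Rightarrow> nat" where
  "critical_index A =
     Max {j \<in> {1..num_clouds A}. ranked_sell_price A j \<le> ranked_buy_price A 2}"

text \<open>With fewer than two clouds there are no second-ranked bids, hence no winners.\<close>

definition trade :: "auction \<Rightarrow> bool" where
  "trade A \<longleftrightarrow> 2 \<le> num_clouds A \<and> ranked_sell_price A 2 \<le> ranked_buy_price A 2"

definition buy_bid_wins :: "auction \<Rightarrow> nat \<Rightarrow> bool" where
  "buy_bid_wins A i \<longleftrightarrow> trade A \<and> i = buy_order A 1"

definition sell_bid_wins :: "auction \<Rightarrow> nat \<Rightarrow> bool" where
  "sell_bid_wins A i \<longleftrightarrow> trade A \<and> i \<in> sell_order A ` {1..critical_index A - 1}"

definition charged_price :: "auction \<Rightarrow> nat \<Rightarrow> real" where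
  "charged_price A i = (if buy_bid_wins A i then ranked_buy_price A 2 else 0)"

definition bought_qty :: "auction \<Rightarrow> nat \<Rightarrow> nat" where
  "bought_qty A i =
     (if buy_bid_wins A i then \<Sum>j = 1..critical_index A - 1. ranked_sell_qty A j else 0)"

definition paid_price :: "auction \<Rightarrow> nat \<Rightarrow> real" where
  "paid_price A i =
     (if sell_bid_wins A i then ranked_sell_price A (critical_index A) else 0)"

definition sold_qty :: "auction \<Rightarrow> nat \<Rightarrow> nat" where
  "sold_qty A i = (if sell_bid_wins A i then sell_qty A i else 0)"

text \<open>
  The auction for VM type \<open>m\<close> in slot \<open>t\<close>: cloud \<open>i\<close> has \<open>N i m\<close> servers for this type, each hosting
  at most \<open>C i m\<close> such VMs, and bids the prices \<open>b i m t\<close> and \<open>s i m t\<close>; the orders used to rank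
  the bids are \<open>\<sigma> m t\<close> (buy) and \<open>\<tau> m t\<close> (sell).
\<close>

definition vm_auction ::
  "nat \<Rightarrow> (nat \<Rightarrow> nat \<Rightarrow> nat) \<Rightarrow> (nat \<Rightarrow> nat \<Rightarrow> nat) \<Rightarrow>
   (nat \<Rightarrow> nat \<Rightarrow> nat \<Rightarrow> real) \<Rightarrow> (nat \<Rightarrow> nat \<Rightarrow> nat \<Rightarrow> real) \<Rightarrow>
   (nat \<Rightarrow> nat \<Rightarrow> nat \<Rightarrow> nat) \<Rightarrow> (nat \<Rightarrow> nat \<Rightarrow> nat \<Rightarrow> nat) \<Rightarrow>
   nat \<Rightarrow> nat \<Rightarrow> auction" where
  "vm_auction F C N b s \<sigma> \<tau> m t =
     \<lparr> num_clouds = F,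
       buy_price = (\<lambda>i. b i m t),
       buy_qty = (\<lambda>i. \<Sum>j = 1..F. C j m * N j m),
       sell_price = (\<lambda>i. s i m t),
       sell_qty = (\<lambda>i. C i m * N i m),
       buy_order = \<sigma> m t,
       sell_order = \<tau> m t \<rparr>"

end

theory Submission
  imports Defs
begin

text \<open>Each winner trades at a price taken from a bid ranked after its own. The winning buyer
  holds rank 1 and is charged the rank-2 buy price; a winning seller has a rank below the critical
  index and is paid the sell price at that index. Since the orders sort the prices, however ties are
  broken, \<open>charged_price_le_buy_price\<close> and \<open>sell_price_le_paid_price\<close>
  follow by monotonicity, once the ranks compared are known to be genuine.\<close>

text \<open>Under \<open>trade\<close> rank 2 lies in the finite set defining the critical index, so
  its \<open>Max\<close> is attained and \<open>ascending_order\<close> can be applied at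
  it.\<close>

lemma critical_index_mem:
  assumes "trade A"
  shows "critical_index A \<in> {1..num_clouds A}"
proof -
  let ?J = "{j \<in> {1..num_clouds A}. ranked_sell_price A j \<le> ranked_buy_price A 2}"
  have "2 \<in> ?J"
    using assms by (simp add: trade_def)
  then have "Max ?J \<in> ?J"
    by (intro Max_in) auto
  then show ?thesis
    by (simp add: critical_index_def)
qed

text \<open>A win implies \<open>trade\<close>, hence at least two clouds, so ranks 1 and 2 both lie
  in the range where the order is monotone.\<close>

lemma charged_price_le_buy_price:
  assumes "descending_order (num_clouds A) (buy_price A) (buy_order A)"
    and "buy_bid_wins A i"
  shows "charged_price A i \<le> buy_price A i"
  using assms
  by (auto simp: charged_price_def buy_bid_wins_def trade_def ranked_buy_price_def
      descending_order_def)

lemma sell_price_le_paid_price: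
  assumes order: "ascending_order (num_clouds A) (sell_price A) (sell_order A)"
    and wins: "sell_bid_wins A i"
  shows "sell_price A i \<le> paid_price A i"
proof -
  obtain j where j: "j \<in> {1..critical_index A - 1}" and i: "i = sell_order A j"
    using wins by (auto simp: sell_bid_wins_def)
  have crit: "critical_index A \<in> {1..num_clouds A}"
    using wins critical_index_mem by (simp add: sell_bid_wins_def del: atLeastAtMost_iff)
  \<comment> \<open>The bound on the critical index carries over to the winner's rank
    \<open>j\<close>, so monotonicity compares the two.\<close>
  with j have "j \<in> {1..num_clouds A}" and "j \<le> critical_index A"
    by auto
  with order crit have "sell_price A i \<le> sell_price A (sell_order A (critical_index A))"
    unfolding ascending_order_def i by blast
  then show ?thesis
    using wins by (simp add: paid_price_def ranked_sell_price_def)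
qed

theorem theorem3:
  fixes F M :: nat
    and C N :: "nat \<Rightarrow> nat \<Rightarrow> nat"
    and b s :: "nat \<Rightarrow> nat \<Rightarrow> nat \<Rightarrow> real"
    and \<sigma> \<tau> :: "nat \<Rightarrow> nat \<Rightarrow> nat \<Rightarrow> nat"
  assumes "\<And>m t. m \<in> {1..M} \<Longrightarrow> descending_order F (\<lambda>i. b i m t) (\<sigma> m t)"
    and "\<And>m t. m \<in> {1..M} \<Longrightarrow> ascending_order F (\<lambda>i. s i m t) (\<tau> m t)"
  shows "\<forall>m\<in>{1..M}. \<forall>i\<in>{1..F}. \<forall>t.
     (buy_bid_wins (vm_auction F C N b s \<sigma> \<tau> m t) i \<longrightarrow>
        charged_price (vm_auction F C N b s \<sigma> \<tau> m t) i \<le> b i m t) \<and>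
     (sell_bid_wins (vm_auction F C N b s \<sigma> \<tau> m t) i \<longrightarrow>
        paid_price (vm_auction F C N b s \<sigma> \<tau> m t) i \<ge> s i m t)"
proof (intro ballI allI conjI impI)
  fix m i t
  assume m: "m \<in> {1..M}"
  let ?A = "vm_auction F C N b s \<sigma> \<tau> m t"
  show "charged_price ?A i \<le> b i m t" if "buy_bid_wins ?A i"
    using charged_price_le_buy_price[of ?A i] that assms(1)[OF m] by (simp add: vm_auction_def)
  show "paid_price ?A i \<ge> s i m t" if "sell_bid_wins ?A i"
    using sell_price_le_paid_price[of ?A i] that assms(2)[OF m] by (simp add: vm_auction_def)
qed

end
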